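(* Let $n\geq 3$ and let $\alpha,\beta\in\mathcal{DPC}_n$. Then $\alpha\mathrel{\mathscr{J}}\beta$ in $\mathcal{DPC}_n$ if and only if one of the following properties is satisfied: (1) $|\mathrm{Dom}(\alpha)|=|\mathrm{Dom}(\beta)|\leq 1$; (2) $|\mathrm{Dom}(\alpha)|=|\mathrm{Dom}(\beta)|=2$ and $\mathrm{d}(i_1,i_2)=\mathrm{d}(i'_1,i'_2)$, where $\mathrm{Dom}(\alpha)=\{i_1,i_2\}$ and $\mathrm{Dom}(\beta)=\{i'_1,i'_2\}$; (3) $|\mathrm{Dom}(\alpha)|=|\mathrm{Dom}(\beta)|=k\geq 3$ and there exists $\sigma\in\mathcal{D}_{2k}$ such that $$\begin{pmatrix} i'_1&i'_2&\cdots&i'_k\\ i_{1\sigma}&i_{2\sigma}&\cdots&i_{k\sigma}\end{pmatrix}\in\mathcal{DPC}_n,$$ where $\mathrm{Dom}(\alpha)=\{i_1<i_2<\cdots<i_k\}$ and $\mathrm{Dom}(\beta)=\{i'_1<i'_2<\cdots<i'_k\}$.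
   Context: For $n\geq3$, $C_n$ is the cycle graph with vertex set $\{1,\ldots,n\}$ and edges $\{i,i+1\}$ ($1\leq i\leq n-1$) and $\{1,n\}$; $\mathrm{d}(x,y)=\min\{|x-y|,n-|x-y|\}$ is the geodesic distance in $C_n$. $\mathcal{DPC}_n$ is the monoid, under composition (maps written on the right), of all partial isometries of $C_n$, i.e. of all partial transformations $\alpha$ of $\{1,\ldots,n\}$ (including the empty one) such that $\mathrm{d}(x\alpha,y\alpha)=\mathrm{d}(x,y)$ for all $x,y\in\mathrm{Dom}(\alpha)$. $\mathscr{J}$ is Green's relation: in a monoid $M$, $a\mathrel{\mathscr{J}}b$ iff $MaM=MbM$. For $k\geq3$, $\mathcal{D}_{2k}$ is the dihedral group of order $2k$, realized as the group of permutations of $\{1,\ldots,k\}$ generated by $i\mapsto i+1$ ($i<k$), $k\mapsto1$, and by $i\mapsto k+1-i$; $p\sigma$ denotes the image of $p$ under $\sigma$. The two-row array denotes the partial transformation with domain the top row sending each top entry to the entry below it. *)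

theory Defs
  imports "HOL-Algebra.Sym_Groups" "HOL-Algebra.Generated_Groups"
begin

section \<open>Partial isometries of the cycle graph\<close>

text \<open>Geodesic distance between the vertices \<open>x, y \<in> {1..n}\<close> of the cycle graph on \<open>n\<close> vertices;
  integer-valued in order to avoid truncated subtraction.\<close>

definition cycle_dist :: "nat \<Rightarrow> nat \<Rightarrow> nat \<Rightarrow> int" where
  "cycle_dist n x y = min \<bar>int x - int y\<bar> (int n - \<bar>int x - int y\<bar>)"

text \<open>A partial transformation of \<open>{1..n}\<close> is a map \<open>nat \<rightharpoonup> nat\<close> that is undefined outside
  \<open>{1..n}\<close> and takes its values in \<open>{1..n}\<close>.\<close>

definition partial_isometries :: "nat \<Rightarrow> (nat \<rightharpoonup> nat) set" where
  "partial_isometries n =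
     {\<alpha>. dom \<alpha> \<subseteq> {1..n} \<and> ran \<alpha> \<subseteq> {1..n} \<and>
          (\<forall>x\<in>dom \<alpha>. \<forall>y\<in>dom \<alpha>. cycle_dist n (the (\<alpha> x)) (the (\<alpha> y)) = cycle_dist n x y)}"

text \<open>Maps act on the right: the product \<open>\<alpha>\<beta>\<close> applies \<open>\<alpha>\<close> first.\<close>

definition DPC :: "nat \<Rightarrow> (nat \<rightharpoonup> nat) monoid" where
  "DPC n = \<lparr>carrier = partial_isometries n,
            mult = (\<lambda>\<alpha> \<beta>. \<beta> \<circ>\<^sub>m \<alpha>),
            one = (\<lambda>x. if x \<in> {1..n} then Some x else None)\<rparr>"

lemma partial_isometries_iff:
  "\<alpha> \<in> partial_isometries n \<longleftrightarrow>
     (\<forall>x a. \<alpha> x = Some a \<longrightarrow> x \<in> {1..n} \<and> a \<in> {1..n}) \<and>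
     (\<forall>x y a b. \<alpha> x = Some a \<longrightarrow> \<alpha> y = Some b \<longrightarrow> cycle_dist n a b = cycle_dist n x y)"
proof -
  have "dom \<alpha> \<subseteq> {1..n} \<and> ran \<alpha> \<subseteq> {1..n} \<longleftrightarrow>
      (\<forall>x a. \<alpha> x = Some a \<longrightarrow> x \<in> {1..n} \<and> a \<in> {1..n})"
    unfolding dom_def ran_def by blast
  moreover have "(\<forall>x\<in>dom \<alpha>. \<forall>y\<in>dom \<alpha>. cycle_dist n (the (\<alpha> x)) (the (\<alpha> y)) = cycle_dist n x y) \<longleftrightarrow>
      (\<forall>x y a b. \<alpha> x = Some a \<longrightarrow> \<alpha> y = Some b \<longrightarrow> cycle_dist n a b = cycle_dist n x y)"
    by (safe; force simp: dom_def)
  ultimately show ?thesis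
    unfolding partial_isometries_def by blast
qed

lemma DPC_monoid: "monoid (DPC n)"
proof
  fix \<alpha> \<beta> assume "\<alpha> \<in> carrier (DPC n)" "\<beta> \<in> carrier (DPC n)"
  then show "\<alpha> \<otimes>\<^bsub>DPC n\<^esub> \<beta> \<in> carrier (DPC n)"
    by (auto simp only: DPC_def partial_object.simps monoid.simps partial_isometries_iff map_comp_Some_iff)
next
  fix \<alpha> \<beta> \<gamma>
  show "\<alpha> \<otimes>\<^bsub>DPC n\<^esub> \<beta> \<otimes>\<^bsub>DPC n\<^esub> \<gamma> = \<alpha> \<otimes>\<^bsub>DPC n\<^esub> (\<beta> \<otimes>\<^bsub>DPC n\<^esub> \<gamma>)"
    by (rule ext) (simp add: DPC_def map_comp_def split: option.split)
next
  show "\<one>\<^bsub>DPC n\<^esub> \<in> carrier (DPC n)"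
    by (simp add: DPC_def partial_isometries_iff)
next
  fix \<alpha> assume "\<alpha> \<in> carrier (DPC n)"
  then have \<alpha>: "x \<in> {1..n} \<and> a \<in> {1..n}" if "\<alpha> x = Some a" for x a
    using that by (simp add: DPC_def partial_isometries_iff)
  show "\<one>\<^bsub>DPC n\<^esub> \<otimes>\<^bsub>DPC n\<^esub> \<alpha> = \<alpha>"
  proof
    fix x show "(\<one>\<^bsub>DPC n\<^esub> \<otimes>\<^bsub>DPC n\<^esub> \<alpha>) x = \<alpha> x"
      using \<alpha>[of x] by (cases "\<alpha> x") (simp_all add: DPC_def map_comp_def)
  qed
  show "\<alpha> \<otimes>\<^bsub>DPC n\<^esub> \<one>\<^bsub>DPC n\<^esub> = \<alpha>"
  proof
    fix x show "(\<alpha> \<otimes>\<^bsub>DPC n\<^esub> \<one>\<^bsub>DPC n\<^esub>) x = \<alpha> x"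
      using \<alpha>[of x] by (cases "\<alpha> x") (simp_all add: DPC_def map_comp_def)
  qed
qed

section \<open>Green's relation J\<close>

definition two_sided_ideal :: "('a, 'b) monoid_scheme \<Rightarrow> 'a \<Rightarrow> 'a set" where
  "two_sided_ideal M a = {x \<otimes>\<^bsub>M\<^esub> a \<otimes>\<^bsub>M\<^esub> y | x y. x \<in> carrier M \<and> y \<in> carrier M}"

definition green_J :: "('a, 'b) monoid_scheme \<Rightarrow> 'a \<Rightarrow> 'a \<Rightarrow> bool" where
  "green_J M a b \<longleftrightarrow> two_sided_ideal M a = two_sided_ideal M b"

section \<open>The dihedral group of order 2k\<close>

definition rotation :: "nat \<Rightarrow> nat \<Rightarrow> nat" where
  "rotation k i = (if i \<in> {1..<k} then i + 1 else if i = k then 1 else i)"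

definition reflection :: "nat \<Rightarrow> nat \<Rightarrow> nat" where
  "reflection k i = (if i \<in> {1..k} then k + 1 - i else i)"

definition dihedral :: "nat \<Rightarrow> (nat \<Rightarrow> nat) set" where
  "dihedral k = generate (sym_group k) {rotation k, reflection k}"

lemma rotation_reflection_in_sym_group:
  assumes "k \<ge> 1"
  shows "rotation k \<in> carrier (sym_group k)" "reflection k \<in> carrier (sym_group k)"
proof -
  have "bij_betw (rotation k) {1..k} {1..k}"
    by (rule bij_betw_byWitness[where f' = "\<lambda>i. if i = 1 then k else i - 1"])
       (use assms in \<open>auto simp: rotation_def\<close>)
  moreover have "rotation k i = i" if "i \<notin> {1..k}" for i
    using that assms by (auto simp: rotation_def)
  ultimately have "rotation k permutes {1..k}"
    by (rule bij_imp_permutes)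
  then show "rotation k \<in> carrier (sym_group k)"
    by (simp add: sym_group_def)
  have "bij_betw (reflection k) {1..k} {1..k}"
    by (rule bij_betw_byWitness[where f' = "reflection k"])
       (auto simp: reflection_def)
  then have "reflection k permutes {1..k}"
    by (rule bij_imp_permutes) (auto simp: reflection_def)
  then show "reflection k \<in> carrier (sym_group k)"
    by (simp add: sym_group_def)
qed

section \<open>Two-row arrays\<close>

text \<open>The \<open>p\<close>-th smallest element of a finite set, for \<open>1 \<le> p \<le> card A\<close>.\<close>

definition nth_elem :: "nat set \<Rightarrow> nat \<Rightarrow> nat" where
  "nth_elem A p = sorted_list_of_set A ! (p - 1)"

text \<open>The partial transformation with domain \<open>{f 1, \<dots>, f k}\<close> sending \<open>f p\<close> to \<open>g p\<close>; it is intended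
  for \<open>f\<close> injective on \<open>{1..k}\<close>.\<close>

definition two_row :: "nat \<Rightarrow> (nat \<Rightarrow> nat) \<Rightarrow> (nat \<Rightarrow> nat) \<Rightarrow> (nat \<rightharpoonup> nat)" where
  "two_row k f g = map_of (map (\<lambda>p. (f p, g p)) [1..<k + 1])"

end

theory Submission
  imports Defs "HOL-Number_Theory.Cong"
begin

text \<open>\<open>\<alpha>\<close> and \<open>\<beta>\<close> are \<open>\<J>\<close>-related iff some partial isometry maps the domain of one onto that
  of the other. Every partial isometry is a restriction of an element of the dihedral group of
  order \<open>2n\<close>. One step of the rotation of \<open>{1..n}\<close> changes the ranks of the elements of a
  \<open>k\<close>-subset by the identity or, if the subset contains \<open>n\<close>, by the rotation of \<open>{1..k}\<close>, and
  the reflection of \<open>{1..n}\<close> changes them by the reflection of \<open>{1..k}\<close>; so every element of the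
  dihedral group of order \<open>2n\<close> acts on ranks as an element of the dihedral group of order \<open>2k\<close>.\<close>

section \<open>Ranks and two-row arrays\<close>

lemma bij_betw_nth_elem:
  assumes "finite A"
  shows "bij_betw (nth_elem A) {1..card A} A"
proof -
  have "bij_betw (\<lambda>i. i - 1) {1..card A} {..<card A}"
    by (rule bij_betw_byWitness[where f' = Suc]) auto
  moreover have "bij_betw ((!) (sorted_list_of_set A)) {..<card A} A"
    using assms by (intro bij_betw_nth) auto
  ultimately have "bij_betw ((!) (sorted_list_of_set A) \<circ> (\<lambda>i. i - 1)) {1..card A} A"
    by (rule bij_betw_trans)
  moreover have "(!) (sorted_list_of_set A) \<circ> (\<lambda>i. i - 1) = nth_elem A"
    by (auto simp: nth_elem_def)
  ultimately show ?thesis by simp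
qed

lemma nth_elem_less:
  assumes "1 \<le> p" "p < q" "q \<le> card A"
  shows "nth_elem A p < nth_elem A q"
  unfolding nth_elem_def
  using assms by (intro sorted_wrt_nth_less[OF strict_sorted_list_of_set]) auto

text \<open>The values of \<open>f\<close> listed in order are already sorted and distinct, so they
  form the sorted list of the image. This lets ranks in an image be read off from any increasing
  enumeration.\<close>

lemma nth_elem_image_eq:
  assumes "strict_mono_on {1..k} f" "p \<in> {1..k}"
  shows "nth_elem (f ` {1..k}) p = f p"
proof -
  have inj: "inj_on f {1..k}"
    using assms(1) by (rule strict_mono_on_imp_inj_on)
  have "sorted (map f [1..<Suc k])"
    by (intro sorted_map_mono mono_on_subset[OF strict_mono_on_imp_mono_on[OF assms(1)]])
       (auto simp del: upt_Suc)
  moreover have "distinct (map f [1..<Suc k])"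
    using inj by (simp add: distinct_map atLeastLessThanSuc_atLeastAtMost del: upt_Suc)
  ultimately have "sorted_list_of_set (set (map f [1..<Suc k])) = map f [1..<Suc k]"
    by (rule sorted_list_of_set.idem_if_sorted_distinct)
  moreover have "set (map f [1..<Suc k]) = f ` {1..k}"
    by (simp add: atLeastLessThanSuc_atLeastAtMost del: upt_Suc)
  ultimately show ?thesis
    using assms(2) by (cases p) (simp_all add: nth_elem_def del: upt_Suc)
qed

text \<open>Injectivity of \<open>f\<close> makes the keys of the association list distinct, so the
  first match found by \<open>map_of\<close> is the only one.\<close>

lemma two_row_eq_Some_iff:
  assumes "inj_on f {1..k}"
  shows "two_row k f g x = Some y \<longleftrightarrow> (\<exists>p\<in>{1..k}. x = f p \<and> y = g p)"
proof -
  have "distinct (map fst (map (\<lambda>p. (f p, g p)) [1..<Suc k]))"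
    using assms by (simp add: o_def distinct_map atLeastLessThanSuc_atLeastAtMost del: upt_Suc)
  from map_of_eq_Some_iff[OF this, of x y] show ?thesis
    by (auto simp add: two_row_def atLeastLessThanSuc_atLeastAtMost simp del: upt_Suc)
qed

section \<open>The action of the dihedral group on ranks\<close>

lemma subgroup_dihedral: "k \<ge> 1 \<Longrightarrow> subgroup (dihedral k) (sym_group k)"
  unfolding dihedral_def
  by (intro group.generate_is_subgroup sym_group_is_group) (auto simp: rotation_reflection_in_sym_group)

lemma dihedral_permutes: "k \<ge> 1 \<Longrightarrow> \<sigma> \<in> dihedral k \<Longrightarrow> \<sigma> permutes {1..k}"
  using subgroup.subset[OF subgroup_dihedral] by (auto simp: sym_group_def)

lemma id_in_dihedral: "k \<ge> 1 \<Longrightarrow> id \<in> dihedral k"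
  using subgroup.one_closed[OF subgroup_dihedral] by (simp add: sym_group_def)

lemma comp_in_dihedral:
  "k \<ge> 1 \<Longrightarrow> \<sigma> \<in> dihedral k \<Longrightarrow> \<tau> \<in> dihedral k \<Longrightarrow> \<sigma> \<circ> \<tau> \<in> dihedral k"
  using subgroup.m_closed[OF subgroup_dihedral, of k \<sigma> \<tau>] by (simp add: sym_group_def)

lemma inv_in_dihedral:
  assumes "k \<ge> 1" "\<sigma> \<in> dihedral k"
  shows "inv' \<sigma> \<in> dihedral k"
proof -
  have "\<sigma> \<in> carrier (sym_group k)"
    using subgroup.mem_carrier[OF subgroup_dihedral] assms by blast
  then show ?thesis
    using subgroup.m_inv_closed[OF subgroup_dihedral, of k \<sigma>] assms
    by (simp add: sym_group_inv_equality)
qed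

lemma rotation_in_dihedral: "rotation k \<in> dihedral k"
  and reflection_in_dihedral: "reflection k \<in> dihedral k"
  unfolding dihedral_def by (auto intro: generate.incl)

text \<open>The permutation \<open>\<sigma>\<close> depends on the set: the same \<open>g\<close>
  can induce different rank permutations on different sets \<open>A\<close>. Hence the property is
  attached to the pair of \<open>A\<close> and \<open>g\<close>.\<close>

definition dihedral_on_ranks :: "nat set \<Rightarrow> (nat \<Rightarrow> nat) \<Rightarrow> bool" where
  "dihedral_on_ranks A g \<longleftrightarrow>
     (\<exists>\<sigma>\<in>dihedral (card A). \<forall>p\<in>{1..card A}. g (nth_elem A p) = nth_elem (g ` A) (\<sigma> p))"

text \<open>Since \<open>\<sigma>\<close> permutes the ranks, \<open>f\<close> has the same image as
  \<open>f \<circ> \<sigma>\<close>, namely the image of \<open>A\<close> under \<open>g\<close>.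
  Being increasing, \<open>f\<close> is then the rank enumeration of that image.\<close>

lemma dihedral_on_ranksI:
  assumes "finite A" "A \<noteq> {}" "\<sigma> \<in> dihedral (card A)"
    and "strict_mono_on {1..card A} f"
    and eq: "\<And>p. p \<in> {1..card A} \<Longrightarrow> g (nth_elem A p) = f (\<sigma> p)"
  shows "dihedral_on_ranks A g"
proof -
  have k: "card A \<ge> 1" using assms(1,2) by (simp add: Suc_leI card_gt_0_iff)
  have \<sigma>: "\<sigma> permutes {1..card A}" using dihedral_permutes[OF k assms(3)] .
  have "g ` A = g ` nth_elem A ` {1..card A}"
    using bij_betw_imp_surj_on[OF bij_betw_nth_elem[OF assms(1)]] by simp
  also have "\<dots> = f ` \<sigma> ` {1..card A}" unfolding image_image using eq by (rule image_cong[OF refl])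
  also have "\<dots> = f ` {1..card A}" using permutes_image[OF \<sigma>] by simp
  finally have "g ` A = f ` {1..card A}" .
  then have "g (nth_elem A p) = nth_elem (g ` A) (\<sigma> p)" if "p \<in> {1..card A}" for p
    using nth_elem_image_eq[OF assms(4), of "\<sigma> p"] eq[OF that] permutes_in_image[OF \<sigma>] that by simp
  then show ?thesis using assms(3) by (auto simp: dihedral_on_ranks_def)
qed

lemma dihedral_on_ranks_reflection:
  assumes "A \<subseteq> {1..n}" "A \<noteq> {}"
  shows "dihedral_on_ranks A (reflection n)"
proof -
  let ?k = "card A"
  have fin: "finite A" using assms(1) finite_subset by blast
  have mem: "nth_elem A p \<in> {1..n}" if "p \<in> {1..?k}" for p
    using bij_betwE[OF bij_betw_nth_elem[OF fin]] that assms(1) by blast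
  show ?thesis
  proof (rule dihedral_on_ranksI[OF fin assms(2) reflection_in_dihedral])
    \<comment> \<open>The reflection reverses the order, so the element of rank \<open>p\<close> in
      the image comes from the element of rank \<open>?k + 1 - p\<close> in
      \<open>A\<close>.\<close>
    show "strict_mono_on {1..?k} (\<lambda>p. n + 1 - nth_elem A (?k + 1 - p))"
    proof (rule strict_mono_onI)
      fix p q assume pq: "p \<in> {1..?k}" "q \<in> {1..?k}" "p < q"
      then have "nth_elem A (?k + 1 - q) < nth_elem A (?k + 1 - p)"
        by (intro nth_elem_less) auto
      moreover have "nth_elem A (?k + 1 - p) \<in> {1..n}" using pq by (intro mem) auto
      ultimately show "n + 1 - nth_elem A (?k + 1 - p) < n + 1 - nth_elem A (?k + 1 - q)" by auto
    qed
    show "reflection n (nth_elem A p) = n + 1 - nth_elem A (?k + 1 - reflection ?k p)"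
      if "p \<in> {1..?k}" for p
      using that mem[OF that] by (auto simp: reflection_def)
  qed
qed

lemma dihedral_on_ranks_rotation:
  assumes "A \<subseteq> {1..n}" "A \<noteq> {}"
  shows "dihedral_on_ranks A (rotation n)"
proof -
  let ?k = "card A"
  have fin: "finite A" using assms(1) finite_subset by blast
  have k: "?k \<ge> 1" using fin assms(2) by (simp add: Suc_leI card_gt_0_iff)
  have bij: "bij_betw (nth_elem A) {1..?k} A" using fin by (rule bij_betw_nth_elem)
  have mem: "nth_elem A p \<in> A" if "p \<in> {1..?k}" for p
    using bij_betwE[OF bij] that by blast
  have mem': "nth_elem A p \<in> {1..n}" if "p \<in> {1..?k}" for p
    using mem[OF that] assms(1) by blast
  show ?thesis
  proof (cases "n \<in> A")
    case False
    show ?thesis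
    proof (rule dihedral_on_ranksI[OF fin assms(2) id_in_dihedral[OF k]])
      show "strict_mono_on {1..?k} (\<lambda>p. nth_elem A p + 1)"
        by (rule strict_mono_onI) (auto intro: nth_elem_less)
      show "rotation n (nth_elem A p) = nth_elem A (id p) + 1" if "p \<in> {1..?k}" for p
      proof -
        have "nth_elem A p \<noteq> n" using mem[OF that] False by metis
        then show ?thesis using mem'[OF that] by (simp add: rotation_def)
      qed
    qed
  next
    case True
    then have "n \<in> nth_elem A ` {1..?k}" by (simp only: bij_betw_imp_surj_on[OF bij])
    then obtain q where q: "q \<in> {1..?k}" "nth_elem A q = n" by auto
    \<comment> \<open>An element of higher rank would exceed \<open>n\<close>, the largest possible
      element of \<open>A\<close>.\<close>
    have "q = ?k"
    proof (rule ccontr)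
      assume "q \<noteq> ?k"
      then have "n < nth_elem A ?k" using q nth_elem_less[of q ?k A] by auto
      then show False using mem'[of ?k] k by simp
    qed
    with q have last: "nth_elem A ?k = n" by simp
    have less: "nth_elem A p < n" if "1 \<le> p" "p < ?k" for p
      using nth_elem_less[of p ?k A] that last by simp
    show ?thesis
    proof (rule dihedral_on_ranksI[OF fin assms(2) rotation_in_dihedral])
      \<comment> \<open>The image of \<open>n\<close> is 1 and becomes the smallest element; every
        other element grows by one and moves up one rank.\<close>
      show "strict_mono_on {1..?k} (\<lambda>p. if p = 1 then 1 else nth_elem A (p - 1) + 1)"
      proof (rule strict_mono_onI)
        fix p q assume pq: "p \<in> {1..?k}" "q \<in> {1..?k}" "p < q"
        \<comment> \<open>Positivity of this element settles the case \<open>p = 1\<close>, where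
          the left-hand value is 1. For \<open>p > 1\<close> the ranks \<open>p - 1\<close> and
          \<open>q - 1\<close> are compared.\<close>
        then have "nth_elem A (q - 1) \<in> {1..n}" by (intro mem') auto
        then show "(if p = 1 then 1 else nth_elem A (p - 1) + 1) < (if q = 1 then 1 else nth_elem A (q - 1) + 1)"
          using pq nth_elem_less[of "p - 1" "q - 1" A] by auto
      qed
      show "rotation n (nth_elem A p) =
          (if rotation ?k p = 1 then 1 else nth_elem A (rotation ?k p - 1) + 1)"
        if "p \<in> {1..?k}" for p
      proof (cases "p = ?k")
        case True
        then show ?thesis using last k by (simp add: rotation_def)
      next
        case False
        then have "p < ?k" using that by simp
        then show ?thesis using that less[of p] mem'[OF that] by (simp add: rotation_def)
      qed
    qed
  qed
qed

text \<open>The rank permutations compose in the same order as the maps. Injectivity of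
  \<open>g\<close> on \<open>A\<close> keeps the cardinality, so both lie in the same dihedral
  group.\<close>

lemma dihedral_on_ranks_comp:
  assumes "finite A" "A \<noteq> {}" "inj_on g A"
    and g: "dihedral_on_ranks A g" and h: "dihedral_on_ranks (g ` A) h"
  shows "dihedral_on_ranks A (h \<circ> g)"
proof -
  have card: "card (g ` A) = card A" using assms(3) by (rule card_image)
  have k: "card A \<ge> 1" using assms(1,2) by (simp add: Suc_leI card_gt_0_iff)
  obtain \<sigma> where \<sigma>: "\<sigma> \<in> dihedral (card A)"
    "\<And>p. p \<in> {1..card A} \<Longrightarrow> g (nth_elem A p) = nth_elem (g ` A) (\<sigma> p)"
    using g by (auto simp: dihedral_on_ranks_def)
  obtain \<tau> where \<tau>: "\<tau> \<in> dihedral (card A)"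
    "\<And>p. p \<in> {1..card A} \<Longrightarrow> h (nth_elem (g ` A) p) = nth_elem (h ` g ` A) (\<tau> p)"
    using h card by (auto simp: dihedral_on_ranks_def)
  have "(h \<circ> g) (nth_elem A p) = nth_elem ((h \<circ> g) ` A) ((\<tau> \<circ> \<sigma>) p)" if "p \<in> {1..card A}" for p
    using \<sigma>(2)[OF that] \<tau>(2)[of "\<sigma> p"] permutes_in_image[OF dihedral_permutes[OF k \<sigma>(1)]] that
    by (simp add: image_comp)
  then show ?thesis
    using comp_in_dihedral[OF k \<tau>(1) \<sigma>(1)] unfolding dihedral_on_ranks_def by blast
qed

text \<open>The map \<open>g\<close> carries the preimage of \<open>A\<close> onto \<open>A\<close>.
  Inverting the rank permutation of \<open>g\<close> on this preimage gives the rank permutation of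
  \<open>inv' g\<close> on \<open>A\<close>.\<close>

lemma dihedral_on_ranks_inv:
  assumes "finite A" "A \<noteq> {}" "bij g" and g: "dihedral_on_ranks (inv' g ` A) g"
  shows "dihedral_on_ranks A (inv' g)"
proof -
  let ?B = "inv' g ` A"
  have card: "card ?B = card A"
    using assms(3) by (meson bij_betw_def bij_betw_inv_into card_image inj_on_subset subset_UNIV)
  have gB: "g ` ?B = A"
    using assms(3) by (simp add: bij_is_surj image_f_inv_f)
  have k: "card A \<ge> 1" using assms(1,2) by (simp add: Suc_leI card_gt_0_iff)
  obtain \<sigma> where \<sigma>: "\<sigma> \<in> dihedral (card A)"
    "\<And>p. p \<in> {1..card A} \<Longrightarrow> g (nth_elem ?B p) = nth_elem A (\<sigma> p)"
    using g unfolding dihedral_on_ranks_def card gB by blast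
  have perm: "\<sigma> permutes {1..card A}" using dihedral_permutes[OF k \<sigma>(1)] .
  have "inv' g (nth_elem A p) = nth_elem ?B (inv' \<sigma> p)" if "p \<in> {1..card A}" for p
  proof -
    have "inv' \<sigma> p \<in> {1..card A}" using permutes_in_image[OF permutes_inv[OF perm]] that by blast
    then have "g (nth_elem ?B (inv' \<sigma> p)) = nth_elem A p"
      using \<sigma>(2) permutes_inverses(1)[OF perm] by simp
    then show ?thesis using assms(3) by (metis bij_inv_eq_iff)
  qed
  then show ?thesis
    using inv_in_dihedral[OF k \<sigma>(1)] unfolding dihedral_on_ranks_def by blast
qed

text \<open>Induction over the generated group. The set \<open>A\<close> must stay arbitrary,
  because in a product the second map acts on the image of \<open>A\<close> under the first, and for
  an inverse generator the preimage of \<open>A\<close> is used.\<close>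

lemma dihedral_dihedral_on_ranks:
  assumes "g \<in> dihedral n" "A \<subseteq> {1..n}" "A \<noteq> {}"
  shows "dihedral_on_ranks A g"
  using assms unfolding dihedral_def
proof (induction g arbitrary: A rule: generate.induct)
  case one
  then have fin: "finite A" using finite_subset by blast
  then have "id \<in> dihedral (card A)"
    using one by (intro id_in_dihedral) (simp add: Suc_leI card_gt_0_iff)
  then show ?case
    unfolding dihedral_on_ranks_def by (intro bexI[of _ id]) (simp_all add: sym_group_def)
next
  case (incl h)
  then show ?case using dihedral_on_ranks_rotation dihedral_on_ranks_reflection by blast
next
  case (inv h)
  then have n: "n \<ge> 1" by (metis atLeastatMost_empty_iff subset_empty)
  have fin: "finite A" using inv finite_subset by blast
  have h: "h \<in> carrier (sym_group n)"
    using inv(1) rotation_reflection_in_sym_group[OF n] by blast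
  then have perm: "h permutes {1..n}" by (simp add: sym_group_def)
  have sub: "inv' h ` A \<subseteq> {1..n}"
    using inv(2) permutes_image[OF permutes_inv[OF perm]] by blast
  have "dihedral_on_ranks (inv' h ` A) h"
    using inv(1,3) sub dihedral_on_ranks_rotation dihedral_on_ranks_reflection by blast
  then have "dihedral_on_ranks A (inv' h)"
    using fin inv(3) permutes_bij[OF perm] by (intro dihedral_on_ranks_inv)
  then show ?case using sym_group_inv_equality[OF h] by simp
next
  case (eng h1 h2)
  then have n: "n \<ge> 1" by (metis atLeastatMost_empty_iff subset_empty)
  have perm: "h2 permutes {1..n}"
    using dihedral_permutes[OF n] eng(2) by (simp add: dihedral_def)
  have "dihedral_on_ranks A (h1 \<circ> h2)"
  proof (rule dihedral_on_ranks_comp)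
    show "finite A" using eng.prems finite_subset by blast
    show "inj_on h2 A" using permutes_inj[OF perm] inj_on_subset by blast
    show "dihedral_on_ranks (h2 ` A) h1"
      using eng.prems permutes_image[OF perm] by (intro eng.IH) auto
  qed (use eng in auto)
  then show ?case by (simp add: sym_group_def comp_def)
qed

section \<open>Partial isometries are restrictions of dihedral permutations\<close>

lemma cong_interval_eq:
  fixes x y n :: nat
  assumes "x \<in> {1..n}" "y \<in> {1..n}" "[int x = int y] (mod int n)"
  shows "x = y"
proof -
  have "int n dvd int x - int y" using assms(3) by (simp add: cong_iff_dvd_diff)
  moreover have "\<bar>int x - int y\<bar> < int n" using assms(1,2) by auto
  ultimately have "int x - int y = 0" using dvd_imp_le_int[of "int x - int y" "int n"] by fastforce
  then show ?thesis by simp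
qed

text \<open>The witness is the \<open>c\<close>-fold iterate of the rotation.\<close>

lemma rotation_power_dihedral:
  assumes "n \<ge> 1"
  shows "\<exists>g\<in>dihedral n. \<forall>x\<in>{1..n}. [int (g x) = int x + int c] (mod int n)"
proof (induction c)
  case 0
  show ?case using id_in_dihedral[OF assms] by (intro bexI[of _ id]) auto
next
  case (Suc c)
  then obtain g where g: "g \<in> dihedral n" "\<forall>x\<in>{1..n}. [int (g x) = int x + int c] (mod int n)"
    by blast
  \<comment> \<open>Sending \<open>n\<close> to 1 also adds 1 modulo \<open>n\<close>.\<close>
  have rot: "[int (rotation n y) = int y + 1] (mod int n)" if "y \<in> {1..n}" for y
    using that by (auto simp: rotation_def cong_iff_dvd_diff)
  have "[int ((rotation n \<circ> g) x) = int x + int (Suc c)] (mod int n)" if x: "x \<in> {1..n}" for x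
  proof -
    have "g x \<in> {1..n}" using permutes_in_image[OF dihedral_permutes[OF assms g(1)]] x by blast
    then have "[int (rotation n (g x)) = int (g x) + 1] (mod int n)" by (rule rot)
    also have "[int (g x) + 1 = (int x + int c) + 1] (mod int n)"
      using g(2) x by (intro cong_add) auto
    finally show ?thesis by (simp add: algebra_simps)
  qed
  then show ?case
    using comp_in_dihedral[OF assms rotation_in_dihedral g(1)] by blast
qed

lemma dihedral_affine:
  fixes \<epsilon> c :: int
  assumes "n \<ge> 1" "\<epsilon> = 1 \<or> \<epsilon> = - 1"
  shows "\<exists>g\<in>dihedral n. \<forall>x\<in>{1..n}. [int (g x) = \<epsilon> * int x + c] (mod int n)"
proof -
  \<comment> \<open>Iterates of the rotation are indexed by natural numbers, so an integer shift is
    first replaced by its residue.\<close>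
  have nonneg: "\<exists>m. [int m = c] (mod int n)" for c
    using assms(1) by (intro exI[of _ "nat (c mod int n)"]) (simp add: cong_def)
  from assms(2) show ?thesis
  proof
    assume \<epsilon>: "\<epsilon> = 1"
    obtain m where m: "[int m = c] (mod int n)" using nonneg by blast
    obtain g where g: "g \<in> dihedral n" "\<forall>x\<in>{1..n}. [int (g x) = int x + int m] (mod int n)"
      using rotation_power_dihedral[OF assms(1)] by blast
    have "[int (g x) = \<epsilon> * int x + c] (mod int n)" if "x \<in> {1..n}" for x
      using g(2) that cong_add[OF cong_refl[of "int x"] m] \<epsilon> cong_trans by fastforce
    then show ?thesis using g(1) by blast
  next
    assume \<epsilon>: "\<epsilon> = - 1"
    \<comment> \<open>Reflecting first yields \<open>n + 1 - x\<close>, congruent to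
      \<open>1 - x\<close>; a shift by \<open>c - 1\<close> then gives \<open>c - x\<close>.\<close>
    obtain m where m: "[int m = c - 1] (mod int n)" using nonneg by blast
    obtain g where g: "g \<in> dihedral n" "\<forall>x\<in>{1..n}. [int (g x) = int x + int m] (mod int n)"
      using rotation_power_dihedral[OF assms(1)] by blast
    have "[int ((g \<circ> reflection n) x) = \<epsilon> * int x + c] (mod int n)" if x: "x \<in> {1..n}" for x
    proof -
      have r: "reflection n x \<in> {1..n}" "int (reflection n x) = int n + 1 - int x"
        using x by (auto simp: reflection_def)
      have "[int (g (reflection n x)) = (int n + 1 - int x) + int m] (mod int n)"
        using g(2) r by metis
      also have "[(int n + 1 - int x) + int m = (int n + 1 - int x) + (c - 1)] (mod int n)"
        using m by (intro cong_add cong_refl)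
      also have "[(int n + 1 - int x) + (c - 1) = \<epsilon> * int x + c] (mod int n)"
        by (simp add: \<epsilon> cong_iff_dvd_diff)
      finally show ?thesis by simp
    qed
    then show ?thesis
      using comp_in_dihedral[OF assms(1) g(1) reflection_in_dihedral] by blast
  qed
qed

text \<open>The distance determines the difference of two vertices up to sign modulo
  \<open>n\<close>: with differences \<open>u\<close> and \<open>v\<close>, equal distances force
  the absolute values of \<open>u\<close> and \<open>v\<close> to be equal or to sum to
  \<open>n\<close>.\<close>

lemma cycle_dist_eq_dvd:
  assumes "cycle_dist n a b = cycle_dist n x y"
  shows "int n dvd (int a - int b) - (int x - int y) \<or> int n dvd (int a - int b) + (int x - int y)"
proof -
  define u v where "u = int a - int b" and "v = int x - int y"
  have "u - v = 0 \<or> u + v = 0 \<or> u - v = int n \<or> u - v = - int n \<or> u + v = int n \<or> u + v = - int n"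
    using assms unfolding cycle_dist_def u_def[symmetric] v_def[symmetric] min_def
    by (auto simp: abs_if split: if_splits)
  then show ?thesis unfolding u_def[symmetric] v_def[symmetric] by auto
qed

text \<open>Preserving the distance to a base point \<open>z\<close> gives \<open>f x - f z = \<plusminus>(x - z)\<close> with a sign
  depending on \<open>x\<close>. If \<open>w\<close> violates the sign \<open>+\<close> and \<open>x\<close> the sign \<open>-\<close>, then the distance between
  \<open>w\<close> and \<open>x\<close> is not preserved.\<close>

lemma partial_isometry_affine:
  assumes iso: "\<And>x y. x \<in> A \<Longrightarrow> y \<in> A \<Longrightarrow> cycle_dist n (f x) (f y) = cycle_dist n x y"
  shows "\<exists>\<epsilon> c. (\<epsilon> = 1 \<or> \<epsilon> = - 1) \<and> (\<forall>x\<in>A. [int (f x) = \<epsilon> * int x + c] (mod int n))"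
proof (cases "A = {}")
  case False
  then obtain z where z: "z \<in> A" by blast
  define u where "u x = int x - int z" for x
  define v where "v x = int (f x) - int (f z)" for x
  have uv: "int n dvd v x - u x \<or> int n dvd v x + u x" if "x \<in> A" for x
    using cycle_dist_eq_dvd[OF iso[OF that z]] by (simp add: u_def v_def)
  have uv2: "int n dvd (v x - v y) - (u x - u y) \<or> int n dvd (v x - v y) + (u x - u y)"
    if "x \<in> A" "y \<in> A" for x y
    using cycle_dist_eq_dvd[OF iso[OF that]] by (simp add: u_def v_def)
  have "\<exists>\<epsilon>. (\<epsilon> = 1 \<or> \<epsilon> = - 1) \<and> (\<forall>x\<in>A. int n dvd v x - \<epsilon> * u x)"
  proof (cases "\<forall>x\<in>A. int n dvd v x - u x")
    case True
    then show ?thesis by (intro exI[of _ 1]) auto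
  next
    case False
    then obtain w where w: "w \<in> A" "\<not> int n dvd v w - u w" by blast
    then have w': "int n dvd v w + u w" using uv by blast
    have "int n dvd v x + u x" if x: "x \<in> A" for x
    proof (rule ccontr)
      assume not: "\<not> int n dvd v x + u x"
      then have x': "int n dvd v x - u x" using uv x by blast
      from uv2[OF x w(1)] show False
      proof
        assume *: "int n dvd (v x - v w) - (u x - u w)"
        have "v w - u w = (v x - u x) - ((v x - v w) - (u x - u w))" by simp
        then show False using w(2) dvd_diff[OF x' *] by simp
      next
        assume *: "int n dvd (v x - v w) + (u x - u w)"
        have "v x + u x = (v w + u w) + ((v x - v w) + (u x - u w))" by simp
        then show False using not dvd_add[OF w' *] by simp
      qed
    qed
    then show ?thesis by (intro exI[of _ "- 1"]) auto
  qed
  then obtain \<epsilon> where \<epsilon>: "\<epsilon> = 1 \<or> \<epsilon> = - 1" "\<forall>x\<in>A. int n dvd v x - \<epsilon> * u x" by blast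
  \<comment> \<open>The constant term is chosen so that the affine map agrees with \<open>f\<close>
    at the base point \<open>z\<close>.\<close>
  have "[int (f x) = \<epsilon> * int x + (int (f z) - \<epsilon> * int z)] (mod int n)" if "x \<in> A" for x
  proof -
    have "int (f x) - (\<epsilon> * int x + (int (f z) - \<epsilon> * int z)) = v x - \<epsilon> * u x"
      by (simp add: u_def v_def algebra_simps)
    then show ?thesis using \<epsilon>(2) that by (simp add: cong_iff_dvd_diff)
  qed
  then show ?thesis using \<epsilon>(1) by blast
qed auto

text \<open>The affine formula for \<open>\<gamma>\<close> is realised modulo \<open>n\<close> by
  some dihedral \<open>g\<close>. Both take values in \<open>{1..n}\<close>, where congruent numbers
  are equal.\<close>

lemma partial_isometry_dihedral:
  assumes "n \<ge> 1" "\<gamma> \<in> partial_isometries n"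
  shows "\<exists>g\<in>dihedral n. \<forall>x\<in>dom \<gamma>. \<gamma> x = Some (g x)"
proof -
  have dom: "dom \<gamma> \<subseteq> {1..n}" and ran: "ran \<gamma> \<subseteq> {1..n}"
    and iso: "\<And>x y. x \<in> dom \<gamma> \<Longrightarrow> y \<in> dom \<gamma> \<Longrightarrow>
      cycle_dist n (the (\<gamma> x)) (the (\<gamma> y)) = cycle_dist n x y"
    using assms(2) by (auto simp: partial_isometries_def)
  obtain \<epsilon> c where \<epsilon>: "\<epsilon> = 1 \<or> \<epsilon> = - 1"
    and c: "\<forall>x\<in>dom \<gamma>. [int (the (\<gamma> x)) = \<epsilon> * int x + c] (mod int n)"
    using partial_isometry_affine[of "dom \<gamma>" n "\<lambda>x. the (\<gamma> x)"] iso by blast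
  obtain g where g: "g \<in> dihedral n" "\<forall>x\<in>{1..n}. [int (g x) = \<epsilon> * int x + c] (mod int n)"
    using dihedral_affine[OF assms(1) \<epsilon>] by blast
  have "\<gamma> x = Some (g x)" if x: "x \<in> dom \<gamma>" for x
  proof -
    obtain y where y: "\<gamma> x = Some y" using x by blast
    have "y \<in> {1..n}" using ran y by (auto simp: ran_def)
    moreover have "g x \<in> {1..n}"
      using permutes_in_image[OF dihedral_permutes[OF assms(1) g(1)]] x dom by blast
    moreover have "[int y = int (g x)] (mod int n)"
      using c g(2) x dom y by (metis cong_sym cong_trans option.sel subsetD)
    ultimately show ?thesis using cong_interval_eq y by blast
  qed
  then show ?thesis using g(1) by blast
qed

section \<open>Green's relation J\<close>

lemma cycle_dist_eq_0_iff:
  assumes "x \<in> {1..n}" "y \<in> {1..n}"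
  shows "cycle_dist n x y = 0 \<longleftrightarrow> x = y"
  using assms by (auto simp: cycle_dist_def min_def)

lemma cycle_dist_commute: "cycle_dist n x y = cycle_dist n y x"
  by (simp add: cycle_dist_def abs_minus_commute)

text \<open>Two points with a common image are at distance 0, hence equal.\<close>

lemma partial_isometry_inj:
  assumes "\<gamma> \<in> partial_isometries n" "\<gamma> x = Some a" "\<gamma> y = Some a"
  shows "x = y"
proof -
  have "x \<in> {1..n}" "y \<in> {1..n}" "a \<in> {1..n}" "cycle_dist n a a = cycle_dist n x y"
    using assms unfolding partial_isometries_iff by blast+
  then show ?thesis using cycle_dist_eq_0_iff by metis
qed

lemma partial_isometry_converse:
  assumes "\<gamma> \<in> partial_isometries n"
  shows "\<exists>\<delta>\<in>partial_isometries n. \<forall>x y. \<delta> y = Some x \<longleftrightarrow> \<gamma> x = Some y"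
proof
  let ?\<delta> = "\<lambda>y. if y \<in> ran \<gamma> then Some (THE x. \<gamma> x = Some y) else None"
  show conv: "\<forall>x y. ?\<delta> y = Some x \<longleftrightarrow> \<gamma> x = Some y"
  proof (intro allI)
    fix x y
    show "?\<delta> y = Some x \<longleftrightarrow> \<gamma> x = Some y"
    proof (cases "y \<in> ran \<gamma>")
      case True
      then obtain z where z: "\<gamma> z = Some y" by (auto simp: ran_def)
      then have "(THE x. \<gamma> x = Some y) = z"
        using partial_isometry_inj[OF assms] by blast
      then show ?thesis using True z partial_isometry_inj[OF assms] by auto
    qed (auto simp: ran_def)
  qed
  \<comment> \<open>The conditions in \<open>partial_isometries_iff\<close> are symmetric under
    exchange of arguments and values.\<close>
  show "?\<delta> \<in> partial_isometries n"
    using assms unfolding partial_isometries_iff conv[rule_format] by metis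
qed

lemma partial_isometry_comp:
  "\<gamma> \<in> partial_isometries n \<Longrightarrow> \<delta> \<in> partial_isometries n \<Longrightarrow> \<delta> \<circ>\<^sub>m \<gamma> \<in> partial_isometries n"
  using monoid.m_closed[OF DPC_monoid, of \<gamma> n \<delta>] by (simp add: DPC_def)

lemma finite_dom_partial_isometry: "\<gamma> \<in> partial_isometries n \<Longrightarrow> finite (dom \<gamma>)"
  unfolding partial_isometries_def using finite_subset by blast

lemma card_ran_partial_isometry:
  assumes "\<gamma> \<in> partial_isometries n"
  shows "card (ran \<gamma>) = card (dom \<gamma>)"
proof -
  have "inj_on (\<lambda>x. the (\<gamma> x)) (dom \<gamma>)"
    using partial_isometry_inj[OF assms] by (intro inj_onI) auto
  moreover have "ran \<gamma> = (\<lambda>x. the (\<gamma> x)) ` dom \<gamma>"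
    by (force simp: ran_def image_iff)
  ultimately show ?thesis by (simp add: card_image)
qed

section \<open>Principal two-sided ideals and isometries between domains\<close>

lemma mem_two_sided_ideal_self:
  assumes "monoid M" "a \<in> carrier M"
  shows "a \<in> two_sided_ideal M a"
  using assms unfolding two_sided_ideal_def
  by (intro CollectI exI[of _ "\<one>\<^bsub>M\<^esub>"]) (simp add: monoid.one_closed monoid.l_one monoid.r_one)

lemma two_sided_ideal_mono:
  assumes "monoid M" "a \<in> carrier M" "b \<in> two_sided_ideal M a"
  shows "two_sided_ideal M b \<subseteq> two_sided_ideal M a"
proof
  interpret monoid M by fact
  obtain x y where b: "b = x \<otimes>\<^bsub>M\<^esub> a \<otimes>\<^bsub>M\<^esub> y" and xy: "x \<in> carrier M" "y \<in> carrier M"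
    using assms(3) by (auto simp: two_sided_ideal_def)
  fix c assume "c \<in> two_sided_ideal M b"
  then obtain u v where c: "c = u \<otimes>\<^bsub>M\<^esub> b \<otimes>\<^bsub>M\<^esub> v" and uv: "u \<in> carrier M" "v \<in> carrier M"
    by (auto simp: two_sided_ideal_def)
  have "c = (u \<otimes>\<^bsub>M\<^esub> x) \<otimes>\<^bsub>M\<^esub> a \<otimes>\<^bsub>M\<^esub> (y \<otimes>\<^bsub>M\<^esub> v)"
    using assms(2) xy uv by (simp add: b c m_assoc)
  then show "c \<in> two_sided_ideal M a"
    unfolding two_sided_ideal_def using xy uv by blast
qed

text \<open>If \<beta> is the product of \<xi>, \<alpha> and \<eta>, then \<xi> must be defined on
  the domain of \<beta> and send it into the domain of \<alpha>. Its restriction to the domain of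
  \<beta> is the isometry sought.\<close>

lemma two_sided_ideal_imp_isometry:
  assumes "\<beta> \<in> two_sided_ideal (DPC n) \<alpha>"
  shows "\<exists>\<gamma>\<in>partial_isometries n. dom \<gamma> = dom \<beta> \<and> ran \<gamma> \<subseteq> dom \<alpha>"
proof -
  obtain \<xi> \<eta> where \<beta>: "\<beta> = \<eta> \<circ>\<^sub>m (\<alpha> \<circ>\<^sub>m \<xi>)" and \<xi>: "\<xi> \<in> partial_isometries n"
    using assms by (auto simp: two_sided_ideal_def DPC_def)
  have "\<xi> |` dom \<beta> \<in> partial_isometries n"
    using \<xi> unfolding partial_isometries_iff by (metis restrict_in restrict_out option.distinct(1))
  moreover have "dom (\<xi> |` dom \<beta>) = dom \<beta>"
    by (auto simp: \<beta> map_comp_def split: option.splits)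
  moreover have "ran (\<xi> |` dom \<beta>) \<subseteq> dom \<alpha>"
    by (auto simp: \<beta> ran_def restrict_map_def map_comp_def split: option.splits if_splits)
  ultimately show ?thesis by blast
qed

lemma isometry_imp_two_sided_ideal:
  assumes \<alpha>: "\<alpha> \<in> partial_isometries n" and \<beta>: "\<beta> \<in> partial_isometries n"
    and \<gamma>: "\<gamma> \<in> partial_isometries n" "dom \<gamma> = dom \<beta>" "ran \<gamma> \<subseteq> dom \<alpha>"
  shows "\<beta> \<in> two_sided_ideal (DPC n) \<alpha>"
proof -
  obtain \<alpha>' where \<alpha>': "\<alpha>' \<in> partial_isometries n" "\<And>x y. \<alpha>' y = Some x \<longleftrightarrow> \<alpha> x = Some y"
    using partial_isometry_converse[OF \<alpha>] by blast
  obtain \<gamma>' where \<gamma>': "\<gamma>' \<in> partial_isometries n" "\<And>x y. \<gamma>' y = Some x \<longleftrightarrow> \<gamma> x = Some y"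
    using partial_isometry_converse[OF \<gamma>(1)] by blast
  \<comment> \<open>The right factor undoes \<alpha>, then \<gamma>, and finally applies \<beta>.
    Thus a point of the domain of \<beta> goes out along \<gamma> and \<alpha>, returns to itself
    and is then mapped by \<beta>.\<close>
  let ?\<eta> = "\<beta> \<circ>\<^sub>m (\<gamma>' \<circ>\<^sub>m \<alpha>')"
  have "(?\<eta> \<circ>\<^sub>m (\<alpha> \<circ>\<^sub>m \<gamma>)) x = \<beta> x" for x
  proof (cases "\<gamma> x")
    case None
    then have "\<beta> x = None" using \<gamma>(2) by (metis domIff)
    then show ?thesis using None by (simp add: map_comp_def)
  next
    case (Some y)
    then obtain z where z: "\<alpha> y = Some z" using \<gamma>(3) by (auto simp: ran_def)
    then have "\<alpha>' z = Some y" "\<gamma>' y = Some x" using \<alpha>'(2) \<gamma>'(2) Some by auto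
    then show ?thesis using Some z by (simp add: map_comp_def)
  qed
  then have "\<beta> = \<gamma> \<otimes>\<^bsub>DPC n\<^esub> \<alpha> \<otimes>\<^bsub>DPC n\<^esub> ?\<eta>"
    by (auto simp: DPC_def)
  moreover have "\<gamma> \<in> carrier (DPC n)" "?\<eta> \<in> carrier (DPC n)"
    using \<gamma>(1) partial_isometry_comp[OF partial_isometry_comp[OF \<alpha>'(1) \<gamma>'(1)] \<beta>]
    by (simp_all add: DPC_def)
  ultimately show ?thesis unfolding two_sided_ideal_def by blast
qed

lemma green_J_DPC_iff:
  assumes "\<alpha> \<in> partial_isometries n" "\<beta> \<in> partial_isometries n"
  shows "green_J (DPC n) \<alpha> \<beta> \<longleftrightarrow> (\<exists>\<gamma>\<in>partial_isometries n. dom \<gamma> = dom \<beta> \<and> ran \<gamma> = dom \<alpha>)"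
proof
  have carrier: "\<alpha> \<in> carrier (DPC n)" "\<beta> \<in> carrier (DPC n)"
    using assms by (simp_all add: DPC_def)
  {
    assume "green_J (DPC n) \<alpha> \<beta>"
    then have "\<beta> \<in> two_sided_ideal (DPC n) \<alpha>" "\<alpha> \<in> two_sided_ideal (DPC n) \<beta>"
      using mem_two_sided_ideal_self[OF DPC_monoid] carrier unfolding green_J_def by blast+
    then obtain \<gamma> \<delta> where \<gamma>: "\<gamma> \<in> partial_isometries n" "dom \<gamma> = dom \<beta>" "ran \<gamma> \<subseteq> dom \<alpha>"
      and \<delta>: "\<delta> \<in> partial_isometries n" "dom \<delta> = dom \<alpha>" "ran \<delta> \<subseteq> dom \<beta>"
      using two_sided_ideal_imp_isometry by metis
    \<comment> \<open>The injection \<open>\<delta>\<close> in the opposite direction bounds the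
      cardinality; by finiteness, \<open>\<gamma>\<close> then maps onto the whole domain of
      \<open>\<alpha>\<close>.\<close>
    have "card (dom \<alpha>) \<le> card (dom \<beta>)"
      using card_mono[OF finite_dom_partial_isometry[OF assms(2)] \<delta>(3)]
        card_ran_partial_isometry[OF \<delta>(1)] \<delta>(2) by simp
    then have "ran \<gamma> = dom \<alpha>"
      using card_ran_partial_isometry[OF \<gamma>(1)] \<gamma>(2,3) finite_dom_partial_isometry[OF assms(1)]
      by (intro card_seteq) simp_all
    then show "\<exists>\<gamma>\<in>partial_isometries n. dom \<gamma> = dom \<beta> \<and> ran \<gamma> = dom \<alpha>" using \<gamma> by blast
  }
  assume "\<exists>\<gamma>\<in>partial_isometries n. dom \<gamma> = dom \<beta> \<and> ran \<gamma> = dom \<alpha>"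
  then obtain \<gamma> where \<gamma>: "\<gamma> \<in> partial_isometries n" "dom \<gamma> = dom \<beta>" "ran \<gamma> = dom \<alpha>" by blast
  obtain \<delta> where \<delta>: "\<delta> \<in> partial_isometries n" "\<And>x y. \<delta> y = Some x \<longleftrightarrow> \<gamma> x = Some y"
    using partial_isometry_converse[OF \<gamma>(1)] by blast
  have "dom \<delta> = ran \<gamma>" "ran \<delta> = dom \<gamma>"
    unfolding dom_def ran_def using \<delta>(2) by auto
  then have "\<beta> \<in> two_sided_ideal (DPC n) \<alpha>" "\<alpha> \<in> two_sided_ideal (DPC n) \<beta>"
    using isometry_imp_two_sided_ideal assms \<gamma> \<delta>(1) by auto
  then show "green_J (DPC n) \<alpha> \<beta>"
    unfolding green_J_def using two_sided_ideal_mono[OF DPC_monoid] carrier by blast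
qed

section \<open>Existence of an isometry from one given set onto another\<close>

lemma isometry_two_points_iff:
  assumes "a \<in> {1..n}" "b \<in> {1..n}" "x \<in> {1..n}" "y \<in> {1..n}" "x \<noteq> y"
  shows "(\<exists>\<gamma>\<in>partial_isometries n. dom \<gamma> = {x, y} \<and> ran \<gamma> = {a, b})
    \<longleftrightarrow> cycle_dist n a b = cycle_dist n x y"
proof
  assume "\<exists>\<gamma>\<in>partial_isometries n. dom \<gamma> = {x, y} \<and> ran \<gamma> = {a, b}"
  then obtain \<gamma> where \<gamma>: "\<gamma> \<in> partial_isometries n" "dom \<gamma> = {x, y}" "ran \<gamma> = {a, b}" by blast
  obtain c d where cd: "\<gamma> x = Some c" "\<gamma> y = Some d" using \<gamma>(2) by blast
  have "ran \<gamma> = {c, d}"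
    unfolding ran_def using \<gamma>(2) cd by (auto, metis domI insertE option.inject singletonD)
  then have "{c, d} = {a, b}" using \<gamma>(3) by simp
  \<comment> \<open>The isometry may match the two pairs in either order; symmetry of the distance
    covers both.\<close>
  moreover have "cycle_dist n c d = cycle_dist n x y"
    using \<gamma>(1) cd unfolding partial_isometries_iff by blast
  ultimately show "cycle_dist n a b = cycle_dist n x y"
    using cycle_dist_commute by (metis doubleton_eq_iff)
next
  assume *: "cycle_dist n a b = cycle_dist n x y"
  have refl: "cycle_dist n z z = min 0 (int n)" for z by (simp add: cycle_dist_def)
  have "[x \<mapsto> a, y \<mapsto> b] \<in> partial_isometries n"
    unfolding partial_isometries_iff
    using assms * cycle_dist_commute[of n b a] cycle_dist_commute[of n y x] refl
    by (auto split: if_splits)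
  moreover have "dom [x \<mapsto> a, y \<mapsto> b] = {x, y}" by auto
  moreover have "ran [x \<mapsto> a, y \<mapsto> b] = {a, b}" using assms(5) by auto
  ultimately show "\<exists>\<gamma>\<in>partial_isometries n. dom \<gamma> = {x, y} \<and> ran \<gamma> = {a, b}" by blast
qed

text \<open>An isometry from \<open>B\<close> onto \<open>A\<close> is the restriction of a dihedral
  \<open>g\<close> on \<open>{1..n}\<close>. The rank permutation of \<open>g\<close> on
  \<open>B\<close> is the required \<open>\<sigma>\<close>, and the two-row array is the isometry
  itself. Conversely, \<open>\<sigma>\<close> permutes the ranks, so the array maps \<open>B\<close>
  onto \<open>A\<close>.\<close>

lemma isometry_iff_dihedral:
  assumes "A \<subseteq> {1..n}" "B \<subseteq> {1..n}" "card A = k" "card B = k" "k \<ge> 1"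
  shows "(\<exists>\<gamma>\<in>partial_isometries n. dom \<gamma> = B \<and> ran \<gamma> = A)
    \<longleftrightarrow> (\<exists>\<sigma>\<in>dihedral k. two_row k (nth_elem B) (\<lambda>p. nth_elem A (\<sigma> p)) \<in> partial_isometries n)"
proof
  have fin: "finite A" "finite B" using assms finite_subset by blast+
  have A: "bij_betw (nth_elem A) {1..k} A" and B: "bij_betw (nth_elem B) {1..k} B"
    using bij_betw_nth_elem[OF fin(1)] bij_betw_nth_elem[OF fin(2)] assms by simp_all
  note two_row = two_row_eq_Some_iff[OF bij_betw_imp_inj_on[OF B]]
  {
    assume "\<exists>\<gamma>\<in>partial_isometries n. dom \<gamma> = B \<and> ran \<gamma> = A"
    then obtain \<gamma> where \<gamma>: "\<gamma> \<in> partial_isometries n" "dom \<gamma> = B" "ran \<gamma> = A" by blast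
    have n: "n \<ge> 1" using assms by (cases n) auto
    obtain g where g: "g \<in> dihedral n" "\<And>x. x \<in> B \<Longrightarrow> \<gamma> x = Some (g x)"
      using partial_isometry_dihedral[OF n \<gamma>(1)] \<gamma>(2) by blast
    have "g ` B = A"
    proof (intro equalityI subsetI)
      fix y assume "y \<in> A"
      then obtain x where x: "\<gamma> x = Some y" using \<gamma>(3) by (auto simp: ran_def)
      then have "x \<in> B" using \<gamma>(2) by blast
      then show "y \<in> g ` B" using g(2) x by force
    qed (use g(2) \<gamma>(3) in \<open>auto simp: ran_def\<close>)
    moreover have "dihedral_on_ranks B g"
      using g(1) assms by (intro dihedral_dihedral_on_ranks[of _ n]) auto
    ultimately obtain \<sigma> where \<sigma>: "\<sigma> \<in> dihedral k"
      "\<And>p. p \<in> {1..k} \<Longrightarrow> g (nth_elem B p) = nth_elem A (\<sigma> p)"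
      using assms(4) unfolding dihedral_on_ranks_def by blast
    have "two_row k (nth_elem B) (\<lambda>p. nth_elem A (\<sigma> p)) x = Some y \<longleftrightarrow> \<gamma> x = Some y" for x y
    proof -
      have "\<gamma> x = Some y \<longleftrightarrow> x \<in> B \<and> y = g x"
        using g(2) \<gamma>(2) by (metis domI option.inject)
      also have "\<dots> \<longleftrightarrow> (\<exists>p\<in>{1..k}. x = nth_elem B p \<and> y = g x)"
        using bij_betw_imp_surj_on[OF B] by blast
      also have "\<dots> \<longleftrightarrow> (\<exists>p\<in>{1..k}. x = nth_elem B p \<and> y = nth_elem A (\<sigma> p))"
        using \<sigma>(2) by metis
      finally show ?thesis unfolding two_row by (rule sym)
    qed
    then have "two_row k (nth_elem B) (\<lambda>p. nth_elem A (\<sigma> p)) = \<gamma>"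
      by (intro ext) (metis not_Some_eq)
    then show "\<exists>\<sigma>\<in>dihedral k. two_row k (nth_elem B) (\<lambda>p. nth_elem A (\<sigma> p)) \<in> partial_isometries n"
      using \<sigma>(1) \<gamma>(1) by blast
  }
  assume "\<exists>\<sigma>\<in>dihedral k. two_row k (nth_elem B) (\<lambda>p. nth_elem A (\<sigma> p)) \<in> partial_isometries n"
  then obtain \<sigma> where \<sigma>: "\<sigma> \<in> dihedral k"
    and iso: "two_row k (nth_elem B) (\<lambda>p. nth_elem A (\<sigma> p)) \<in> partial_isometries n" by blast
  let ?\<gamma> = "two_row k (nth_elem B) (\<lambda>p. nth_elem A (\<sigma> p))"
  have "dom ?\<gamma> = nth_elem B ` {1..k}"
    using two_row unfolding dom_def by auto
  moreover have "ran ?\<gamma> = nth_elem A ` \<sigma> ` {1..k}"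
    using two_row unfolding ran_def by auto
  ultimately have "dom ?\<gamma> = B" "ran ?\<gamma> = A"
    using bij_betw_imp_surj_on[OF A] bij_betw_imp_surj_on[OF B]
      permutes_image[OF dihedral_permutes[OF assms(5) \<sigma>]] by simp_all
  with iso show "\<exists>\<gamma>\<in>partial_isometries n. dom \<gamma> = B \<and> ran \<gamma> = A" by blast
qed

theorem proposition1p3:
  fixes n :: nat and \<alpha> \<beta> :: "nat \<rightharpoonup> nat"
  assumes "n \<ge> 3"
    and "\<alpha> \<in> carrier (DPC n)" and "\<beta> \<in> carrier (DPC n)"
  shows "green_J (DPC n) \<alpha> \<beta> \<longleftrightarrow>
      (card (dom \<alpha>) = card (dom \<beta>) \<and> card (dom \<beta>) \<le> 1)
    \<or> (card (dom \<alpha>) = 2 \<and> card (dom \<beta>) = 2 \<and>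
        (\<exists>i\<^sub>1 i\<^sub>2 i'\<^sub>1 i'\<^sub>2. dom \<alpha> = {i\<^sub>1, i\<^sub>2} \<and> dom \<beta> = {i'\<^sub>1, i'\<^sub>2} \<and>
           cycle_dist n i\<^sub>1 i\<^sub>2 = cycle_dist n i'\<^sub>1 i'\<^sub>2))
    \<or> (\<exists>k\<ge>3. card (dom \<alpha>) = k \<and> card (dom \<beta>) = k \<and>
        (\<exists>\<sigma>\<in>dihedral k.
           two_row k (nth_elem (dom \<beta>)) (\<lambda>p. nth_elem (dom \<alpha>) (\<sigma> p)) \<in> carrier (DPC n)))"
proof -
  let ?A = "dom \<alpha>" and ?B = "dom \<beta>"
  let ?iso = "\<exists>\<gamma>\<in>partial_isometries n. dom \<gamma> = ?B \<and> ran \<gamma> = ?A"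
  have \<alpha>: "\<alpha> \<in> partial_isometries n" and \<beta>: "\<beta> \<in> partial_isometries n"
    using assms(2,3) by (simp_all add: DPC_def)
  have sub: "?A \<subseteq> {1..n}" "?B \<subseteq> {1..n}"
    using \<alpha> \<beta> by (simp_all add: partial_isometries_def)
  have fin: "finite ?A" "finite ?B"
    using \<alpha> \<beta> finite_dom_partial_isometry by blast+
  have card: "card ?A = card ?B" if ?iso
    using that card_ran_partial_isometry by metis
  \<comment> \<open>With at most one point the only distance to preserve is that of a vertex to
    itself, which is 0.\<close>
  have small: ?iso if c: "card ?A = card ?B" "card ?B \<le> 1"
  proof (cases "card ?B = 0")
    case True
    then have "?A = {}" "?B = {}" using c fin by simp_all
    then show ?thesis
      by (intro bexI[of _ Map.empty]) (auto simp: partial_isometries_iff)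
  next
    case False
    then have "card ?A = 1" "card ?B = 1" using c by auto
    then obtain a b where ab: "?A = {a}" "?B = {b}" by (auto simp: card_1_singleton_iff)
    then have "[b \<mapsto> a] \<in> partial_isometries n"
      using sub by (auto simp: partial_isometries_iff cycle_dist_def)
    then show ?thesis using ab by (intro bexI[of _ "[b \<mapsto> a]"]) auto
  qed
  have two: "?iso \<longleftrightarrow> (\<exists>i\<^sub>1 i\<^sub>2 i'\<^sub>1 i'\<^sub>2. ?A = {i\<^sub>1, i\<^sub>2} \<and> ?B = {i'\<^sub>1, i'\<^sub>2} \<and>
      cycle_dist n i\<^sub>1 i\<^sub>2 = cycle_dist n i'\<^sub>1 i'\<^sub>2)" if c: "card ?A = 2" "card ?B = 2"
  proof -
    \<comment> \<open>This holds for every listing of the two domains, so it applies both to a fixed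
      listing and to the one supplied by the existential statement.\<close>
    have *: "?iso \<longleftrightarrow> cycle_dist n a b = cycle_dist n x y" if "?A = {a, b}" "?B = {x, y}" for a b x y
    proof -
      have "x \<noteq> y" using c that by auto
      moreover have "a \<in> {1..n}" "b \<in> {1..n}" "x \<in> {1..n}" "y \<in> {1..n}" using sub that by auto
      ultimately show ?thesis using isometry_two_points_iff that by simp
    qed
    obtain a b where A: "?A = {a, b}" using c(1) by (auto simp only: card_2_iff)
    obtain x y where B: "?B = {x, y}" using c(2) by (auto simp only: card_2_iff)
    show ?thesis
    proof
      assume ?iso
      then have "cycle_dist n a b = cycle_dist n x y" by (rule iffD1[OF *[OF A B]])
      with A B show "\<exists>i\<^sub>1 i\<^sub>2 i'\<^sub>1 i'\<^sub>2. ?A = {i\<^sub>1, i\<^sub>2} \<and> ?B = {i'\<^sub>1, i'\<^sub>2} \<and>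
          cycle_dist n i\<^sub>1 i\<^sub>2 = cycle_dist n i'\<^sub>1 i'\<^sub>2"
        by (intro exI conjI)
    qed (elim exE conjE, rule iffD2[OF *])
  qed
  have large: "?iso \<longleftrightarrow> (\<exists>\<sigma>\<in>dihedral k.
      two_row k (nth_elem ?B) (\<lambda>p. nth_elem ?A (\<sigma> p)) \<in> carrier (DPC n))"
    if "k \<ge> 3" "card ?A = k" "card ?B = k" for k
    using isometry_iff_dihedral[OF sub that(2,3)] that(1) by (simp add: DPC_def)
  have J: "green_J (DPC n) \<alpha> \<beta> \<longleftrightarrow> ?iso" using \<alpha> \<beta> by (rule green_J_DPC_iff)
  \<comment> \<open>The size of the domain of \<beta> leaves only one of the three alternatives
    possible. If the cardinalities differ, neither an isometry nor any alternative exists.\<close>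
  consider "card ?B \<le> 1" | "card ?B = 2" | "card ?B \<ge> 3" by linarith
  then show ?thesis
  proof cases
    case 1
    then have "?iso \<longleftrightarrow> card ?A = card ?B" using card small by blast
    with 1 show ?thesis unfolding J by linarith
  next
    case 2
    show ?thesis
    proof (cases "card ?A = 2")
      case True
      show ?thesis unfolding J two[OF True 2] using 2 True by simp
    next
      case False
      then have "\<not> ?iso" using card 2 by metis
      then show ?thesis unfolding J using 2 False by simp
    qed
  next
    case 3
    show ?thesis
    proof (cases "card ?A = card ?B")
      case True
      show ?thesis unfolding J large[OF 3 True refl] using 3 True by simp
    next
      case False
      then have "\<not> ?iso" using card by blast
      then show ?thesis unfolding J using 3 False by auto
    qed
  qed
qed

end
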